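(* For $b=1.37542$ it holds that $\chi(G_{[1, b]})\le 8$.
   Context: For real $b>1$, $G_{[1,b]}$ is the graph with vertex set $\mathbb{R}^2$ in which two points $x,y$ are adjacent if and only if their Euclidean distance satisfies $1\le \mathrm{dist}(x,y)\le b$. $\chi(G)$ denotes the chromatic number, i.e. the minimal cardinality of a set of colors for which there is a function from the vertices to colors giving different colors to adjacent vertices. *)

theory Defs
  imports "HOL-Analysis.Analysis" "HOL-Library.Extended_Nat" "Graph_Theory.Pair_Digraph"
begin

(* A simple undirected graph is a loop-free symmetric pair digraph, with each edge represented
   by its two arcs.  The finiteness built into the library's graph locales is not wanted here;
   annulus_graph_wf, annulus_graph_sym and annulus_graph_loopfree below record the rest. *)

definition proper_colouring :: "'v pair_pre_digraph \<Rightarrow> 'c set \<Rightarrow> ('v \<Rightarrow> 'c) \<Rightarrow> bool" where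
  "proper_colouring G C f \<longleftrightarrow>
     f \<in> pverts G \<rightarrow> C \<and> (\<forall>(x, y) \<in> parcs G. f x \<noteq> f y)"

(* All infinite cardinalities are identified with \<infinity>, the value when no finite set of colours
   suffices.  Finite sets of colours may be taken inside nat without loss of generality,
   see chromatic_number_le_card. *)
definition chromatic_number :: "'v pair_pre_digraph \<Rightarrow> enat" where
  "chromatic_number G = Inf {enat (card C) |C :: nat set. finite C \<and> (\<exists>f. proper_colouring G C f)}"

definition annulus_graph :: "real \<Rightarrow> (real ^ 2) pair_pre_digraph" where
  "annulus_graph b =
     \<lparr> pverts = UNIV, parcs = {(x, y). 1 \<le> dist x y \<and> dist x y \<le> b} \<rparr>"

lemma annulus_graph_wf: "pair_wf_digraph (annulus_graph b)"
  by unfold_locales (auto simp: annulus_graph_def)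

lemma annulus_graph_sym: "sym (parcs (annulus_graph b))"
  by (auto simp: annulus_graph_def sym_def dist_commute)

lemma annulus_graph_loopfree: "(x, x) \<notin> parcs (annulus_graph b)"
  by (simp add: annulus_graph_def)

lemma chromatic_number_le_card:
  fixes C :: "'c set"
  assumes wf: "pair_wf_digraph G" and fin: "finite C" and col: "proper_colouring G C f"
  shows "chromatic_number G \<le> enat (card C)"
proof -
  obtain g :: "'c \<Rightarrow> nat" where g: "inj_on g C"
    using fin finite_imp_inj_to_nat_seg by blast
  have "proper_colouring G (g ` C) (g \<circ> f)"
    unfolding proper_colouring_def
  proof (intro conjI ballI, goal_cases)
    case 1
    show ?case using col by (auto simp: proper_colouring_def)
  next
    case (2 e)
    obtain x y where e: "e = (x, y)" by (cases e)
    with 2 wf have "x \<in> pverts G" "y \<in> pverts G"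
      by (auto simp: pair_wf_digraph_def)
    then have "f x \<in> C" "f y \<in> C" "f x \<noteq> f y"
      using col 2 e by (auto simp: proper_colouring_def)
    then show ?case using g e by (auto dest: inj_onD)
  qed
  moreover have "card (g ` C) = card C" using g by (rule card_image)
  ultimately have "enat (card C) \<in>
      {enat (card D) |D :: nat set. finite D \<and> (\<exists>h. proper_colouring G D h)}"
    using fin by (intro CollectI exI[of _ "g ` C"]) auto
  then show ?thesis unfolding chromatic_number_def by (rule Inf_lower)
qed

end

theory Submission
  imports Defs
begin

text \<open>
  Tile the plane by translates of the centrally symmetric hexagon with vertices
  \<open>(\<plusminus>0.48, \<plusminus>0.135)\<close> and \<open>(0, \<plusminus>0.495)\<close>, whose diameter is less than 1. The centres form
  the lattice of points \<open>(0.48 (2 i + j), 0.63 j)\<close>, and the tile with index \<open>(i, j)\<close> gets the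
  colour \<open>2 i - j\<close> modulo 8. The centres of one colour class form a translate of the lattice
  spanned by \<open>(1.92, \<plusminus>1.26)\<close>. The hexagon at \<open>(1.92, 1.26)\<close> has distance
  \<open>sqrt (0.96\<^sup>2 + 0.99\<^sup>2) > 1.379\<close> from the one at the origin, realised between two vertices, and
  all other pairs of tiles of one colour are, up to symmetry, further apart.
\<close>

definition hexagon :: "real \<Rightarrow> real \<Rightarrow> bool" where
  "hexagon x y \<longleftrightarrow> \<bar>x\<bar> \<le> 12 / 25 \<and> \<bar>y\<bar> + 3 / 4 * \<bar>x\<bar> \<le> 99 / 200"

definition in_tile :: "real \<Rightarrow> real \<Rightarrow> int \<Rightarrow> int \<Rightarrow> bool" where
  "in_tile x y i j \<longleftrightarrow> hexagon (x - 12 / 25 * of_int (2 * i + j)) (y - 63 / 100 * of_int j)"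

lemma ex_in_tile: "\<exists>i j. in_tile x y i j"
proof -
  \<comment> \<open>Row \<open>j\<close> is the highest with centres not above the point; the
    summand 1 / 2 makes \<open>i\<close> the nearest centre in that row.\<close>
  define j where "j = \<lfloor>100 / 63 * y\<rfloor>"
  define i where "i = \<lfloor>(x - 12 / 25 * of_int j) / (24 / 25) + 1 / 2\<rfloor>"
  define u where "u = x - 12 / 25 * of_int (2 * i + j)"
  define v where "v = y - 63 / 100 * of_int j"
  have v: "0 \<le> v" "v \<le> 63 / 100"
    using of_int_floor_le[of "100 / 63 * y"] real_of_int_floor_add_one_ge[of "100 / 63 * y"]
    unfolding v_def j_def by linarith+
  have "of_int i \<le> (x - 12 / 25 * of_int j) / (24 / 25) + 1 / 2"
    "(x - 12 / 25 * of_int j) / (24 / 25) + 1 / 2 \<le> of_int i + 1"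
    unfolding i_def by linarith+
  then have u: "\<bar>u\<bar> \<le> 12 / 25"
    unfolding u_def by (simp add: abs_le_iff field_simps)
  \<comment> \<open>A point of the row strip that lies outside its own tile lies in one of the two tiles above,
    by the central symmetry of the strip cell about \<open>(\<plusminus>6 / 25, 63 / 200)\<close>.\<close>
  consider "v + 3 / 4 * \<bar>u\<bar> \<le> 99 / 200"
    | "v + 3 / 4 * \<bar>u\<bar> > 99 / 200" "u \<ge> 0" | "v + 3 / 4 * \<bar>u\<bar> > 99 / 200" "u < 0"
    by linarith
  then show ?thesis
  proof cases
    case 1
    then have "in_tile x y i j"
      using u v unfolding in_tile_def hexagon_def u_def[symmetric] v_def[symmetric]
      by (intro conjI; linarith)
    then show ?thesis by blast
  next
    case 2
    have *: "x - 12 / 25 * of_int (2 * i + (j + 1)) = u - 12 / 25"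
      "y - 63 / 100 * of_int (j + 1) = v - 63 / 100"
      unfolding u_def v_def by (simp_all add: add_divide_distrib diff_divide_distrib)
    have abs: "\<bar>u\<bar> = u" "\<bar>u - 12 / 25\<bar> = 12 / 25 - u" "\<bar>v - 63 / 100\<bar> = 63 / 100 - v"
      using 2 u v by simp_all
    have "in_tile x y i (j + 1)"
      unfolding in_tile_def hexagon_def * abs using 2[unfolded abs] u v
      by (auto simp: right_diff_distrib distrib_left)
    then show ?thesis by blast
  next
    case 3
    have *: "x - 12 / 25 * of_int (2 * (i - 1) + (j + 1)) = u + 12 / 25"
      "y - 63 / 100 * of_int (j + 1) = v - 63 / 100"
      unfolding u_def v_def by (simp_all add: add_divide_distrib diff_divide_distrib)
    have abs: "\<bar>u\<bar> = - u" "\<bar>u + 12 / 25\<bar> = 12 / 25 + u" "\<bar>v - 63 / 100\<bar> = 63 / 100 - v"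
      using 3 u v by simp_all
    have "in_tile x y (i - 1) (j + 1)"
      unfolding in_tile_def hexagon_def * abs using 3[unfolded abs] u v
      by (auto simp: right_diff_distrib distrib_left)
    then show ?thesis by blast
  qed
qed

text \<open>Differences of two points of one hexagon fill the hexagon scaled by 2, so this bounds
  the diameter of a tile.\<close>

lemma doubled_hexagon_norm_less_1:
  fixes a c :: real
  assumes "\<bar>a\<bar> \<le> 24 / 25" "\<bar>c\<bar> + 3 / 4 * \<bar>a\<bar> \<le> 99 / 100"
  shows "a\<^sup>2 + c\<^sup>2 < 1"
proof -
  have "c\<^sup>2 \<le> (99 / 100 - 3 / 4 * \<bar>a\<bar>)\<^sup>2"
    using assms by (intro abs_le_square_iff[THEN iffD1]) linarith
  \<comment> \<open>Replaces the convex quadratic in \<open>\<bar>a\<bar>\<close> by its chord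
    0.9801 + 0.015 \<open>\<bar>a\<bar>\<close>, which is at most 0.9945.\<close>
  moreover have "\<bar>a\<bar> * \<bar>a\<bar> \<le> 24 / 25 * \<bar>a\<bar>"
    using assms by (intro mult_right_mono) auto
  moreover have "a\<^sup>2 = \<bar>a\<bar> * \<bar>a\<bar>"
    by (simp add: power2_eq_square)
  ultimately show ?thesis
    using assms by (simp add: power2_eq_square algebra_simps)
qed

text \<open>Here \<open>(i, j)\<close> is the difference of two tile indices and
  \<open>(a, c)\<close> that of the offsets from the centres.\<close>

lemma colour_class_separated:
  fixes a c :: real and i j :: int
  assumes z: "\<bar>a\<bar> \<le> 24 / 25" "\<bar>c\<bar> + 3 / 4 * \<bar>a\<bar> \<le> 99 / 100"
    and dvd: "8 dvd 2 * i - j" and nz: "(i, j) \<noteq> (0, 0)"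
  defines "x \<equiv> 12 / 25 * of_int (2 * i + j) + a" and "y \<equiv> 63 / 100 * of_int j + c"
  shows "1.37542\<^sup>2 < x\<^sup>2 + y\<^sup>2"
proof -
  define s where "s = 2 * i + j"
  obtain k where k: "2 * i - j = 8 * k" using dvd by (elim dvdE)
  \<comment> \<open>The centres of the class are (1.92 \<open>n\<close>, 1.26 \<open>m\<close>) with
    \<open>n\<close> and \<open>m\<close> of equal parity, which rules out one of them being 0 and
    the other \<plusminus>1.\<close>
  define m n where "m = i - 4 * k" and "n = i - 2 * k"
  then have sj: "s = 4 * n" "j = 2 * m" and "n = 2 * k + m" "m \<noteq> 0 \<or> n \<noteq> 0"
    using k nz unfolding s_def by auto
  then have "\<bar>n\<bar> \<ge> 2 \<or> \<bar>m\<bar> \<ge> 2 \<or> \<bar>n\<bar> = 1 \<and> \<bar>m\<bar> = 1"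
    by (smt (verit))
  then consider "\<bar>s\<bar> \<ge> 5" | "\<bar>j\<bar> \<ge> 4" | "\<bar>s\<bar> = 4" "\<bar>j\<bar> = 2"
    unfolding sj abs_mult by auto
  then show ?thesis
  proof cases
    case 1
    then have "5 \<le> \<bar>real_of_int s\<bar>" by linarith
    then have "36 / 25 \<le> \<bar>x\<bar>"
      using z unfolding x_def s_def[symmetric] by linarith
    then have "(36 / 25)\<^sup>2 \<le> x\<^sup>2"
      by (intro abs_le_square_iff[THEN iffD1]) simp
    moreover have "1.37542\<^sup>2 < (36 / 25 :: real)\<^sup>2"
      by (simp add: power2_eq_square)
    ultimately show ?thesis
      using zero_le_power2[of y] by linarith
  next
    case 2
    then have "4 \<le> \<bar>real_of_int j\<bar>" by linarith
    then have "153 / 100 \<le> \<bar>y\<bar>"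
      using z unfolding y_def by linarith
    then have "(153 / 100)\<^sup>2 \<le> y\<^sup>2"
      by (intro abs_le_square_iff[THEN iffD1]) simp
    moreover have "1.37542\<^sup>2 < (153 / 100 :: real)\<^sup>2"
      by (simp add: power2_eq_square)
    ultimately show ?thesis
      using zero_le_power2[of x] by linarith
  next
    case 3
    then have "\<bar>real_of_int s\<bar> = 4" "\<bar>real_of_int j\<bar> = 2" by linarith+
    then have *: "48 / 25 - \<bar>a\<bar> \<le> \<bar>x\<bar>" "63 / 50 - \<bar>c\<bar> \<le> \<bar>y\<bar>"
      unfolding x_def y_def s_def[symmetric] by linarith+
    \<comment> \<open>The two hexagons are closest at a pair of vertices differing by \<open>(24 / 25, 99 / 100)\<close>; this
      vector is the normal of a strip separating them.\<close>
    have "(24 / 25)\<^sup>2 + (99 / 100)\<^sup>2 \<le> 24 / 25 * \<bar>x\<bar> + 99 / 100 * \<bar>y\<bar>"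
      using * z by (simp add: power2_eq_square)
    \<comment> \<open>Expanding the squares turns the linear bound into
      \<open>x\<^sup>2 + y\<^sup>2\<close> \<ge> 0.9216 + 0.9801 = 1.9017, while
      \<open>1.37542\<^sup>2\<close> < 1.892.\<close>
    moreover have "0 \<le> (\<bar>x\<bar> - 24 / 25)\<^sup>2" "0 \<le> (\<bar>y\<bar> - 99 / 100)\<^sup>2"
      by simp_all
    ultimately show ?thesis
      by (simp add: power2_eq_square algebra_simps)
  qed
qed

lemma same_colour_dist:
  fixes p q :: "real ^ 2"
  assumes p: "in_tile (p $ 1) (p $ 2) i j" and q: "in_tile (q $ 1) (q $ 2) k l"
    and eq: "(2 * i - j) mod 8 = (2 * k - l) mod 8"
  shows "dist p q < 1 \<or> 1.37542 < dist p q"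
proof -
  define u v u' v' where "u = p $ 1 - 12 / 25 * of_int (2 * i + j)"
    and "v = p $ 2 - 63 / 100 * of_int j"
    and "u' = q $ 1 - 12 / 25 * of_int (2 * k + l)" and "v' = q $ 2 - 63 / 100 * of_int l"
  note offsets = this
  have h: "\<bar>u\<bar> \<le> 12 / 25" "\<bar>v\<bar> + 3 / 4 * \<bar>u\<bar> \<le> 99 / 200"
    "\<bar>u'\<bar> \<le> 12 / 25" "\<bar>v'\<bar> + 3 / 4 * \<bar>u'\<bar> \<le> 99 / 200"
    using p q by (simp_all add: in_tile_def hexagon_def offsets)
  then have z: "\<bar>u - u'\<bar> \<le> 24 / 25" "\<bar>v - v'\<bar> + 3 / 4 * \<bar>u - u'\<bar> \<le> 99 / 100"
    using abs_triangle_ineq4[of u u'] abs_triangle_ineq4[of v v'] by linarith+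
  have pq: "p $ 1 - q $ 1 = 12 / 25 * of_int (2 * (i - k) + (j - l)) + (u - u')"
    "p $ 2 - q $ 2 = 63 / 100 * of_int (j - l) + (v - v')"
    by (simp_all add: offsets right_diff_distrib distrib_left)
  have d: "(dist p q)\<^sup>2 = (p $ 1 - q $ 1)\<^sup>2 + (p $ 2 - q $ 2)\<^sup>2"
    by (simp add: dist_vec_def L2_set_def UNIV_2 dist_real_def)
  show ?thesis
  proof (cases "(i - k, j - l) = (0, 0)")
    case True
    then have "(dist p q)\<^sup>2 < 1\<^sup>2"
      using doubled_hexagon_norm_less_1[OF z] unfolding d pq by simp
    then show ?thesis
      using power2_less_imp_less[of "dist p q" 1] by simp
  next
    case False
    have "8 dvd 2 * (i - k) - (j - l)"
      using eq by (simp add: mod_eq_dvd_iff algebra_simps)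
    from colour_class_separated[OF z this False]
    have "1.37542\<^sup>2 < (dist p q)\<^sup>2"
      unfolding d pq .
    then show ?thesis
      using power2_less_imp_less[of "1.37542" "dist p q"] by simp
  qed
qed

theorem theorem5p1:
  fixes b :: real
  assumes "b = 1.37542"
  shows "chromatic_number (annulus_graph b) \<le> 8"
proof -
  \<comment> \<open>Tiles share boundary points; any choice will do, since
    \<open>same_colour_dist\<close> holds for all tiles containing the points.\<close>
  obtain I J where IJ: "\<And>x y. in_tile x y (I x y) (J x y)"
    using ex_in_tile by metis
  define f :: "real ^ 2 \<Rightarrow> int"
    where "f = (\<lambda>p. (2 * I (p $ 1) (p $ 2) - J (p $ 1) (p $ 2)) mod 8)"
  have "f p \<noteq> f q" if "1 \<le> dist p q" "dist p q \<le> b" for p q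
    using same_colour_dist[OF IJ IJ, of p q] that assms unfolding f_def by linarith
  then have "proper_colouring (annulus_graph b) {0..<8} f"
    by (auto simp: proper_colouring_def annulus_graph_def f_def)
  from chromatic_number_le_card[OF annulus_graph_wf _ this] show ?thesis
    by (simp add: numeral_eq_enat)
qed

end
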